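(* Let $0<q<2$, $p>0$ with $pq\ge 1$, and $f\in H^1(\Omega)$. Then $$\|f\|_{L^q(\Omega)}^{2-q}\left(\int_\Omega |f|^q\,dx-\left(\int_\Omega |f|^{1/p}\,dx\right)^{pq}\right)\le C_B'(p,q)\,\|\nabla f\|_{L^2(\Omega)}^2,$$ where $$C_B'(p,q)=\frac{q(pq-1)C_P^2}{2-q}\ \text{ if } 1\le q<2,\qquad C_B'(p,q)=(pq-1)C_P^2\ \text{ if } 0<q<1,$$ and $C_P>0$ is the constant of the Poincaré-Wirtinger inequality on $\Omega$.
   Context: $\Omega\subset\mathbb{R}^d$ ($d\ge1$) is a bounded domain with Lebesgue measure $\mathrm{m}(\Omega)=1$ such that the Poincaré-Wirtinger inequality holds: there is a constant $C_P>0$, depending only on $d$ and $\Omega$, such that $\|f-\bar f\|_{L^2(\Omega)}\le C_P\|\nabla f\|_{L^2(\Omega)}$ for all $f\in H^1(\Omega)$, where $\bar f=\int_\Omega f\,dx$. For $0<q<\infty$, $\|f\|_{L^q(\Omega)}=(\int_\Omega|f|^q\,dx)^{1/q}$ (also when $q<1$). *)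

theory Defs
  imports "HOL-Analysis.Analysis"
begin

primrec Ck :: "nat \<Rightarrow> ('a::euclidean_space \<Rightarrow> real) \<Rightarrow> bool" where
  "Ck 0 \<phi> \<longleftrightarrow> continuous_on UNIV \<phi>"
| "Ck (Suc k) \<phi> \<longleftrightarrow> (\<forall>x. \<phi> differentiable (at x)) \<and>
     (\<forall>i\<in>Basis. Ck k (\<lambda>x. frechet_derivative \<phi> (at x) i))"

(* Elements of C_c^infinity(\<Omega>), identified with their extensions by zero to the whole space. *)
definition test_functions :: "'a::euclidean_space set \<Rightarrow> ('a \<Rightarrow> real) set" where
  "test_functions \<Omega> =
     {\<phi>. (\<forall>k. Ck k \<phi>) \<and> compact (closure {x. \<phi> x \<noteq> 0}) \<and> closure {x. \<phi> x \<noteq> 0} \<subseteq> \<Omega>}"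

definition locally_integrable ::
    "'a::euclidean_space set \<Rightarrow> ('a \<Rightarrow> 'b::euclidean_space) \<Rightarrow> bool" where
  "locally_integrable \<Omega> f \<longleftrightarrow> (\<forall>K. compact K \<and> K \<subseteq> \<Omega> \<longrightarrow> set_integrable lebesgue K f)"

definition has_weak_gradient ::
    "'a::euclidean_space set \<Rightarrow> ('a \<Rightarrow> real) \<Rightarrow> ('a \<Rightarrow> 'a) \<Rightarrow> bool" where
  "has_weak_gradient \<Omega> f g \<longleftrightarrow>
     locally_integrable \<Omega> f \<and> locally_integrable \<Omega> g \<and>
     (\<forall>\<phi>\<in>test_functions \<Omega>. \<forall>i\<in>Basis.
        (LINT x|lebesgue_on \<Omega>. f x * frechet_derivative \<phi> (at x) i) =
        - (LINT x|lebesgue_on \<Omega>. (g x \<bullet> i) * \<phi> x))"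

(* On an open set the weak gradient is unique up to null sets, so the choice of
   representative does not affect integrals over \<Omega>. *)
definition weak_gradient :: "'a::euclidean_space set \<Rightarrow> ('a \<Rightarrow> real) \<Rightarrow> 'a \<Rightarrow> 'a" where
  "weak_gradient \<Omega> f = (SOME g. has_weak_gradient \<Omega> f g)"

definition L2 :: "'a::euclidean_space set \<Rightarrow> ('a \<Rightarrow> 'b::euclidean_space) set" where
  "L2 \<Omega> = {f. f \<in> borel_measurable (lebesgue_on \<Omega>) \<and>
                integrable (lebesgue_on \<Omega>) (\<lambda>x. (norm (f x))\<^sup>2)}"

definition H1 :: "'a::euclidean_space set \<Rightarrow> ('a \<Rightarrow> real) set" where
  "H1 \<Omega> = {f \<in> L2 \<Omega>. \<exists>g\<in>L2 \<Omega>. has_weak_gradient \<Omega> f g}"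

definition Lq_norm ::
    "'a::euclidean_space set \<Rightarrow> real \<Rightarrow> ('a \<Rightarrow> 'b::euclidean_space) \<Rightarrow> real" where
  "Lq_norm \<Omega> q f = (LINT x|lebesgue_on \<Omega>. norm (f x) powr q) powr (1 / q)"

(* The mean of f is its plain integral, since this is used only for sets of measure 1. *)
definition poincare_wirtinger :: "'a::euclidean_space set \<Rightarrow> real \<Rightarrow> bool" where
  "poincare_wirtinger \<Omega> C \<longleftrightarrow>
     (\<forall>f\<in>H1 \<Omega>. Lq_norm \<Omega> 2 (\<lambda>x. f x - (LINT y|lebesgue_on \<Omega>. f y))
                  \<le> C * Lq_norm \<Omega> 2 (weak_gradient \<Omega> f))"

(* Only meaningful for 0 < q < 2. *)
definition beckner_const :: "real \<Rightarrow> real \<Rightarrow> real \<Rightarrow> real" where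
  "beckner_const C p q =
     (if 1 \<le> q then q * (p * q - 1) * C\<^sup>2 / (2 - q) else (p * q - 1) * C\<^sup>2)"

end

(* Only the variance of |f| matters, and it is at most the variance of f, so no chain rule for |f|
   is needed.  With r = 1/p, u = |f| and a s = (\<integral> u^s)^(1/s), log-convexity of s \<mapsto> \<integral> u^s at r, q, 2
   together with 1 - exp(-t) \<le> t bounds the left-hand side by (pq-1) * q/(2-q) * (a q)^2 * ln ((a 2)^2 / (a q)^2).
   For q \<ge> 1 use ln x \<le> x - 1 and a 1 \<le> a q; for q < 1 use log-convexity at q, 1, 2 instead. *)

theory Submission
  imports Defs "HOL-Probability.Probability_Measure"
begin

section \<open>Hoelder inequality and log-convexity of moments\<close>

lemma Youngs_inequality_nonneg:
  fixes a b t :: real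
  assumes "0 \<le> t" "t \<le> 1" "0 \<le> a" "0 \<le> b"
  shows "a powr (1 - t) * b powr t \<le> (1 - t) * a + t * b"
proof (cases "a = 0 \<or> b = 0")
  \<comment> \<open>By the convention \<open>0 powr t = 0\<close>, which includes
    \<open>t = 0\<close>, a vanishing factor makes the left-hand side 0.\<close>
  case True
  then show ?thesis using assms by auto
next
  case False
  then show ?thesis using assms by (intro Youngs_inequality_0) auto
qed

text \<open>Normalising \<open>u\<close> and \<open>v\<close> to integral 1 lets Young's inequality
  act pointwise; the integrated bound is then \<open>W * ((1 - t) + t) = W\<close>.\<close>

lemma Holder_inequality_integral:
  fixes u v :: "'a \<Rightarrow> real"
  assumes u: "integrable M u" "\<And>x. 0 \<le> u x" "0 < (LINT x|M. u x)"
    and v: "integrable M v" "\<And>x. 0 \<le> v x" "0 < (LINT x|M. v x)"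
    and t: "0 \<le> t" "t \<le> 1"
  shows "(LINT x|M. u x powr (1 - t) * v x powr t)
    \<le> (LINT x|M. u x) powr (1 - t) * (LINT x|M. v x) powr t"
proof -
  define U V where "U = (LINT x|M. u x)" and "V = (LINT x|M. v x)"
  have pos: "U > 0" "V > 0" using u v by (auto simp: U_def V_def)
  define W where "W = U powr (1 - t) * V powr t"
  have W: "W > 0" using pos by (simp add: W_def)
  have "u x powr (1 - t) * v x powr t \<le> W * ((1 - t) * (u x / U) + t * (v x / V))" for x
  proof -
    have "u x powr (1 - t) * v x powr t = W * ((u x / U) powr (1 - t) * (v x / V) powr t)"
      using pos u(2)[of x] v(2)[of x] by (simp add: W_def powr_divide)
    also have "\<dots> \<le> W * ((1 - t) * (u x / U) + t * (v x / V))"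
      using W t u(2)[of x] v(2)[of x] pos by (intro mult_left_mono Youngs_inequality_nonneg) auto
    finally show ?thesis .
  qed
  \<comment> \<open>\<open>integral_mono'\<close> requires integrability only of the dominating
    side, together with its nonnegativity.\<close>
  then have "(LINT x|M. u x powr (1 - t) * v x powr t)
      \<le> (LINT x|M. W * ((1 - t) * (u x / U) + t * (v x / V)))"
    using u v t pos W by (intro integral_mono') auto
  also have "\<dots> = W * ((1 - t) * (U / U) + t * (V / V))"
    using u(1) v(1) by (simp add: U_def V_def)
  also have "\<dots> = W" using pos by simp
  finally show ?thesis by (simp add: W_def U_def V_def)
qed

text \<open>Hoelder applied to \<open>g powr a\<close> and \<open>g powr c\<close>, with
  \<open>t\<close> chosen so that \<open>b\<close> is the convex combination of \<open>a\<close> and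
  \<open>c\<close>. Multiplying through by \<open>c - a\<close> keeps the inequality free of
  quotients and lets it cover \<open>a = c\<close>.\<close>

lemma ln_integral_powr_convex:
  fixes g :: "'a \<Rightarrow> real"
  assumes ord: "a \<le> b" "b \<le> c"
    and int: "integrable M (\<lambda>x. g x powr a)" "integrable M (\<lambda>x. g x powr c)"
    and pos: "0 < (LINT x|M. g x powr a)" "0 < (LINT x|M. g x powr b)" "0 < (LINT x|M. g x powr c)"
  shows "(c - a) * ln (LINT x|M. g x powr b)
    \<le> (c - b) * ln (LINT x|M. g x powr a) + (b - a) * ln (LINT x|M. g x powr c)"
proof (cases "a = c")
  case True
  then show ?thesis using ord by simp
next
  case False
  then have ac: "c - a > 0" using ord by simp
  define t where "t = (b - a) / (c - a)"
  have t: "0 \<le> t" "t \<le> 1" using ord ac by (auto simp: t_def field_simps)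
  have b: "b = a * (1 - t) + c * t"
    using ac by (simp add: t_def divide_simps) (simp add: algebra_simps)
  have "(LINT x|M. g x powr b) = (LINT x|M. (g x powr a) powr (1 - t) * (g x powr c) powr t)"
    by (intro Bochner_Integration.integral_cong) (auto simp: b powr_powr powr_add)
  also have "\<dots> \<le> (LINT x|M. g x powr a) powr (1 - t) * (LINT x|M. g x powr c) powr t"
    using assms t by (intro Holder_inequality_integral) auto
  finally have "ln (LINT x|M. g x powr b)
      \<le> ln ((LINT x|M. g x powr a) powr (1 - t) * (LINT x|M. g x powr c) powr t)"
    using pos by (intro ln_mono) auto
  also have "\<dots> = (1 - t) * ln (LINT x|M. g x powr a) + t * ln (LINT x|M. g x powr c)"
    using pos by (subst ln_mult) auto
  finally have "(c - a) * ln (LINT x|M. g x powr b)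
      \<le> (c - a) * ((1 - t) * ln (LINT x|M. g x powr a) + t * ln (LINT x|M. g x powr c))"
    using ac by (intro mult_left_mono) auto
  moreover have "(c - a) * (1 - t) = c - b" "(c - a) * t = b - a"
    using ac by (simp_all add: t_def field_simps)
  ultimately show ?thesis
    by (simp only: distrib_left mult.assoc[symmetric])
qed

section \<open>Elementary logarithmic inequalities\<close>

lemma mult_ln_divide_le:
  fixes X S :: real
  assumes "0 < X" "0 < S"
  shows "X * (ln S - ln X) \<le> S - X"
proof -
  have "X * ln (S / X) \<le> X * (S / X - 1)"
    using assms by (intro mult_left_mono ln_le_minus_one) auto
  then show ?thesis using assms by (simp add: ln_div algebra_simps)
qed

text \<open>With the weighted geometric mean \<open>Y\<close> of \<open>S\<close> and
  \<open>X\<close>, the left-hand side is \<open>X * ln (S / Y)\<close>. Since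
  \<open>X \<le> Y \<le> S\<close>, it grows when \<open>X\<close> is replaced by \<open>Y\<close>,
  and then \<open>ln x \<le> x - 1\<close> applies. It serves the case \<open>q < 1\<close>.\<close>

lemma powr_mult_ln_divide_le:
  fixes X S \<theta> :: real
  assumes "0 < X" "X \<le> S" "0 \<le> \<theta>" "\<theta> \<le> 1"
  shows "\<theta> * (X * (ln S - ln X)) \<le> S - S powr (1 - \<theta>) * X powr \<theta>"
proof -
  have S: "S > 0" using assms by simp
  define Y where "Y = S powr (1 - \<theta>) * X powr \<theta>"
  have Y: "Y > 0" using assms by (simp add: Y_def)
  have lnY: "ln Y = (1 - \<theta>) * ln S + \<theta> * ln X"
    using assms S unfolding Y_def by (subst ln_mult) auto
  have le: "ln X \<le> ln S" using assms by simp
  have "ln X \<le> ln Y"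
    unfolding lnY using mult_nonneg_nonneg[of "1 - \<theta>" "ln S - ln X"] assms le
    by (simp add: algebra_simps)
  then have XY: "X \<le> Y" using assms Y by simp
  have eq: "\<theta> * (ln S - ln X) = ln S - ln Y" unfolding lnY by (simp add: algebra_simps)
  then have "\<theta> * (X * (ln S - ln X)) = X * (ln S - ln Y)"
    by (simp only: mult.left_commute[of \<theta>])
  also have "\<dots> \<le> Y * (ln S - ln Y)"
    using XY le assms(3) by (intro mult_right_mono) (auto simp flip: eq)
  also have "\<dots> \<le> S - Y" using Y S by (rule mult_ln_divide_le)
  finally show ?thesis by (simp add: Y_def)
qed

section \<open>The inequality on a probability space\<close>

lemma (in finite_measure) integrable_powr_le:
  fixes g :: "'a \<Rightarrow> real"
  assumes "g \<in> borel_measurable M" "\<And>x. 0 \<le> g x" "integrable M (\<lambda>x. g x powr c)"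
    and "0 \<le> s" "s \<le> c"
  shows "integrable M (\<lambda>x. g x powr s)"
proof (rule Bochner_Integration.integrable_bound)
  show "integrable M (\<lambda>x. 1 + g x powr c)" using assms by auto
  have "g x powr s \<le> 1 + g x powr c" for x
  proof (cases "g x \<le> 1")
    case True
    then have "g x powr s \<le> 1" using assms by (intro powr_le1) auto
    then show ?thesis by (simp add: add_increasing2)
  next
    case False
    then have "g x powr s \<le> g x powr c" using assms by (intro powr_mono) auto
    then show ?thesis by simp
  qed
  then show "AE x in M. norm (g x powr s) \<le> norm (1 + g x powr c)" by auto
qed (use assms in measurable)

text \<open>The part of the result that involves no gradient: \<open>g\<close> stands for the
  modulus of \<open>f\<close> and \<open>r\<close> for \<open>1 / p\<close>. The Poincare-Wirtinger
  inequality later turns the variance into the gradient term.\<close>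

lemma (in prob_space) Beckner_variance_bound:
  fixes g :: "'a \<Rightarrow> real" and q r :: real
  assumes g[measurable]: "g \<in> borel_measurable M" and nonneg: "\<And>x. 0 \<le> g x"
    and int2: "integrable M (\<lambda>x. g x powr 2)"
    and qr: "0 < r" "r \<le> q" "q < 2"
  shows "((LINT x|M. g x powr q) powr (1 / q)) powr (2 - q) *
      ((LINT x|M. g x powr q) - (LINT x|M. g x powr r) powr (q / r))
    \<le> (if 1 \<le> q then q * (q / r - 1) / (2 - q) else q / r - 1)
       * ((LINT x|M. g x powr 2) - (LINT x|M. g x)\<^sup>2)"
proof (cases "AE x in M. g x = 0")
  \<comment> \<open>Both sides vanish here; outside this case all moments used are positive and
    logarithms may be taken.\<close>
  case True
  then have "(LINT x|M. g x powr s) = 0" for s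
    by (subst integral_eq_zero_AE) auto
  moreover have "(LINT x|M. g x) = 0" using True by (rule integral_eq_zero_AE)
  ultimately show ?thesis by simp
next
  case False
  define I where "I s = (LINT x|M. g x powr s)" for s
  have int: "integrable M (\<lambda>x. g x powr s)" if "0 \<le> s" "s \<le> 2" for s
    using integrable_powr_le[OF g nonneg int2] that by simp
  have pos: "0 < I s" if "0 \<le> s" "s \<le> 2" for s
  proof -
    have "I s \<noteq> 0"
      using False integral_nonneg_eq_0_iff_AE[OF int[OF that]] by (simp add: I_def)
    moreover have "0 \<le> I s" unfolding I_def by simp
    ultimately show ?thesis by simp
  qed
  have convex: "(c - a) * ln (I b) \<le> (c - b) * ln (I a) + (b - a) * ln (I c)"
    if "0 \<le> a" "a \<le> b" "b \<le> c" "c \<le> 2" for a b c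
    unfolding I_def using that pos int by (intro ln_integral_powr_convex) (auto simp flip: I_def)
  have I1: "(LINT x|M. g x) = I 1" using nonneg by (simp add: I_def)
  have q: "0 < q" using qr by simp
  \<comment> \<open>The squared \<open>q\<close>-norm of \<open>g\<close>, to be compared with the
    squared 2-norm \<open>I 2\<close>.\<close>
  define X where "X = I q powr (2 / q)"
  have X: "0 < X" using pos[of q] q qr by (simp add: X_def)
  have lnX: "ln (I q) = q / 2 * ln X" using q by (simp add: X_def)
  \<comment> \<open>Since \<open>0 powr 0 = 0\<close>, \<open>I 0\<close> is the measure of the set
    where \<open>g\<close> is nonzero, so equality can fail.\<close>
  have I0: "I 0 \<le> 1"
  proof -
    have "I 0 \<le> (LINT x|M. 1)" unfolding I_def using int[of 0]
      by (intro integral_mono) auto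
    then show ?thesis by (simp add: prob_space)
  qed
  \<comment> \<open>Monotonicity of the norms in the exponent, from log-convexity at 0,
    \<open>q\<close>, 2.\<close>
  have XS: "X \<le> I 2"
  proof -
    have "2 * ln (I q) \<le> (2 - q) * ln (I 0) + q * ln (I 2)"
      using convex[of 0 q 2] q qr by simp
    moreover have "(2 - q) * ln (I 0) \<le> 0"
      using I0 pos[of 0] qr by (intro mult_nonneg_nonpos) auto
    ultimately have "q * ln X \<le> q * ln (I 2)" unfolding lnX by simp
    then show ?thesis using q X pos[of 2] by simp
  qed
  define K where "K = (q / r - 1) * (q / (2 - q))"
  have K: "0 \<le> q / r - 1" using qr by (simp add: field_simps)
  define T where "T = X * (ln (I 2) - ln X)"
  have main: "(I q powr (1 / q)) powr (2 - q) * (I q - I r powr (q / r)) \<le> K * T"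
  proof -
    \<comment> \<open>\<open>exp z\<close> is the ratio of the two terms in the difference to be
      bounded. Scaling the convexity inequality by \<open>q / (r * (2 - q))\<close> gives
      \<open>ln (I r)\<close> the coefficient \<open>q / r\<close> that it has in
      \<open>z\<close>.\<close>
    define z where "z = q / r * ln (I r) - ln (I q)"
    have "(2 - r) * ln (I q) \<le> (2 - q) * ln (I r) + (q - r) * ln (I 2)"
      using convex[of r q 2] qr by simp
    then have "q / (r * (2 - q)) * ((2 - r) * ln (I q))
        \<le> q / (r * (2 - q)) * ((2 - q) * ln (I r) + (q - r) * ln (I 2))"
      using qr q by (intro mult_left_mono) auto
    moreover have "q / (r * (2 - q)) * ((2 - q) * ln (I r) + (q - r) * ln (I 2))
        - q / (r * (2 - q)) * ((2 - r) * ln (I q)) = K * (ln (I 2) - ln X) + z"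
      using qr q unfolding K_def z_def lnX by (simp add: divide_simps) (simp add: algebra_simps)
    ultimately have z: "- z \<le> K * (ln (I 2) - ln X)" by linarith
    have Ir: "I r powr (q / r) = I q * exp z"
      using pos[of r] pos[of q] qr q by (simp add: z_def powr_def exp_diff)
    \<comment> \<open>The exponents add up: \<open>(2 - q) / q + 1 = 2 / q\<close>.\<close>
    have "(I q powr (1 / q)) powr (2 - q) * I q = X"
    proof -
      have "(I q powr (1 / q)) powr (2 - q) * I q = I q powr ((2 - q) / q) * I q powr 1"
        using pos[of q] q qr by (simp add: powr_powr)
      also have "\<dots> = X" unfolding powr_add[symmetric] X_def using q by (simp add: field_simps)
      finally show ?thesis .
    qed
    then have "(I q powr (1 / q)) powr (2 - q) * (I q - I r powr (q / r)) = X * (1 - exp z)"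
      unfolding Ir by (simp add: algebra_simps)
    also have "\<dots> \<le> X * (- z)"
      using exp_ge_add_one_self[of z] X by (intro mult_left_mono) linarith+
    also have "\<dots> \<le> X * (K * (ln (I 2) - ln X))"
      using z X by (intro mult_left_mono) auto
    finally show ?thesis by (simp add: T_def mult_ac)
  qed
  show ?thesis
  proof (cases "1 \<le> q")
    case True
    \<comment> \<open>Log-convexity at 0, 1, \<open>q\<close> yields
      \<open>(I 1)\<^sup>2 \<le> X\<close>, so that \<open>I 2 - X\<close> is at most the
      variance.\<close>
    have "q * ln (I 1) \<le> (q - 1) * ln (I 0) + ln (I q)"
      using convex[of 0 1 q] True qr by simp
    moreover have "(q - 1) * ln (I 0) \<le> 0"
      using I0 pos[of 0] True by (intro mult_nonneg_nonpos) auto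
    ultimately have "q * (2 * ln (I 1)) \<le> q * ln X" unfolding lnX by simp
    then have "ln ((I 1)\<^sup>2) \<le> ln X" using q pos[of 1] by (simp add: ln_realpow)
    then have "(I 1)\<^sup>2 \<le> X" using X pos[of 1] by simp
    moreover have "T \<le> I 2 - X"
      unfolding T_def using X pos[of 2] by (intro mult_ln_divide_le) auto
    ultimately have "K * T \<le> K * (I 2 - (I 1)\<^sup>2)"
      using K q qr by (intro mult_left_mono) (auto simp: K_def)
    with main True show ?thesis by (simp add: I1 K_def mult_ac flip: I_def)
  next
    case F: False
    \<comment> \<open>This is the second factor of \<open>K\<close>, and \<open>q < 1\<close> makes
      it at most 1. Log-convexity at \<open>q\<close>, 1, 2 has exactly the weights
      \<open>1 - \<theta>\<close> and \<open>\<theta>\<close> on \<open>ln (I 2)\<close> and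
      \<open>ln X\<close>, so the factor is absorbed and only \<open>q / r - 1\<close>
      remains.\<close>
    define \<theta> where "\<theta> = q / (2 - q)"
    have \<theta>: "0 \<le> \<theta>" "\<theta> \<le> 1" using F q by (auto simp: \<theta>_def field_simps)
    have "(2 - q) * ln (I 1) \<le> ln (I q) + (1 - q) * ln (I 2)"
      using convex[of q 1 2] F q by simp
    then have "2 / (2 - q) * ((2 - q) * ln (I 1)) \<le> 2 / (2 - q) * (ln (I q) + (1 - q) * ln (I 2))"
      using qr by (intro mult_left_mono) auto
    also have "\<dots> = (1 - \<theta>) * ln (I 2) + \<theta> * ln X"
      using qr unfolding lnX \<theta>_def by (simp add: divide_simps) (simp add: algebra_simps)
    also have "\<dots> = ln (I 2 powr (1 - \<theta>) * X powr \<theta>)"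
      using X pos[of 2] by (subst ln_mult) auto
    finally have "ln ((I 1)\<^sup>2) \<le> ln (I 2 powr (1 - \<theta>) * X powr \<theta>)"
      using qr pos[of 1] by (simp add: ln_realpow)
    then have "(I 1)\<^sup>2 \<le> I 2 powr (1 - \<theta>) * X powr \<theta>"
      using X pos[of 1] pos[of 2] by (subst (asm) ln_le_cancel_iff) auto
    moreover have "\<theta> * T \<le> I 2 - I 2 powr (1 - \<theta>) * X powr \<theta>"
      unfolding T_def by (rule powr_mult_ln_divide_le[OF X XS \<theta>])
    ultimately have "(q / r - 1) * (\<theta> * T) \<le> (q / r - 1) * (I 2 - (I 1)\<^sup>2)"
      using K by (intro mult_left_mono) auto
    with main F show ?thesis by (simp add: I1 K_def \<theta>_def mult_ac flip: I_def)
  qed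
qed

section \<open>Application to Sobolev functions on the domain\<close>

lemma Lq_norm_2_squared: "(Lq_norm \<Omega> 2 f)\<^sup>2 = (LINT x|lebesgue_on \<Omega>. (norm (f x))\<^sup>2)"
proof -
  have "(Lq_norm \<Omega> 2 f)\<^sup>2 = Lq_norm \<Omega> 2 f powr 2"
    by (simp add: Lq_norm_def)
  also have "\<dots> = (LINT x|lebesgue_on \<Omega>. norm (f x) powr 2)"
    by (simp add: Lq_norm_def powr_powr)
  finally show ?thesis by simp
qed

theorem lemma4:
  fixes \<Omega> :: "'a::euclidean_space set" and f :: "'a \<Rightarrow> real" and p q C\<^sub>P :: real
  assumes "open \<Omega>" and "connected \<Omega>" and "bounded \<Omega>" and "measure lebesgue \<Omega> = 1"
    and "C\<^sub>P > 0" and "poincare_wirtinger \<Omega> C\<^sub>P"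
    and "0 < q" and "q < 2" and "p > 0" and "p * q \<ge> 1"
    and "f \<in> H1 \<Omega>"
  shows "Lq_norm \<Omega> q f powr (2 - q) *
           ((LINT x|lebesgue_on \<Omega>. \<bar>f x\<bar> powr q)
              - (LINT x|lebesgue_on \<Omega>. \<bar>f x\<bar> powr (1 / p)) powr (p * q))
         \<le> beckner_const C\<^sub>P p q * (Lq_norm \<Omega> 2 (weak_gradient \<Omega> f))\<^sup>2"
proof -
  have \<Omega>: "\<Omega> \<in> sets lebesgue" using assms(1) by (simp add: borel_open sets_completionI_sets)
  interpret prob_space "lebesgue_on \<Omega>"
  proof
    \<comment> \<open>\<open>measure\<close> takes the value 0 on sets of infinite measure, so the
      value 1 excludes that case.\<close>
    have "emeasure lebesgue \<Omega> = 1"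
      using assms(4) emeasure_eq_ennreal_measure[of lebesgue \<Omega>] measure_zero_top[of lebesgue \<Omega>]
      by fastforce
    then show "emeasure (lebesgue_on \<Omega>) (space (lebesgue_on \<Omega>)) = 1"
      using \<Omega> by (simp add: emeasure_restrict_space)
  qed
  have fm: "f \<in> borel_measurable (lebesgue_on \<Omega>)"
    and f2: "integrable (lebesgue_on \<Omega>) (\<lambda>x. (f x)\<^sup>2)"
    using assms(11) by (auto simp: H1_def L2_def)
  have f1: "integrable (lebesgue_on \<Omega>) f"
    using square_integrable_imp_integrable[OF fm f2] .
  let ?E = "\<lambda>h. LINT x|lebesgue_on \<Omega>. h x"
  let ?D = "Lq_norm \<Omega> 2 (weak_gradient \<Omega> f)"
  define k where "k = (if 1 \<le> q then q * (p * q - 1) / (2 - q) else p * q - 1)"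
  have k: "0 \<le> k" using assms by (auto simp: k_def)
  have "variance f = (Lq_norm \<Omega> 2 (\<lambda>x. f x - ?E f))\<^sup>2"
    by (simp add: Lq_norm_2_squared)
  also have "\<dots> \<le> (C\<^sub>P * ?D)\<^sup>2"
    using assms(6,11) by (intro power_mono) (auto simp: poincare_wirtinger_def Lq_norm_def)
  finally have var: "?E (\<lambda>x. (f x)\<^sup>2) - (?E f)\<^sup>2 \<le> C\<^sub>P\<^sup>2 * ?D\<^sup>2"
    using variance_eq[OF f1 f2] by (simp add: power_mult_distrib)
  \<comment> \<open>Passing to the modulus keeps the second moment and can only enlarge the squared
    mean, so the variance does not increase.\<close>
  have "\<bar>?E f\<bar>\<^sup>2 \<le> (?E (\<lambda>x. \<bar>f x\<bar>))\<^sup>2"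
    by (intro power_mono integral_abs_bound) auto
  then have abs_var: "?E (\<lambda>x. \<bar>f x\<bar> powr 2) - (?E (\<lambda>x. \<bar>f x\<bar>))\<^sup>2 \<le> C\<^sub>P\<^sup>2 * ?D\<^sup>2"
    using var by simp
  have pq: "q / (1 / p) = p * q" by simp
  have "1 / p \<le> q" using assms by (simp add: field_simps)
  then have "Lq_norm \<Omega> q f powr (2 - q) *
       (?E (\<lambda>x. \<bar>f x\<bar> powr q) - ?E (\<lambda>x. \<bar>f x\<bar> powr (1 / p)) powr (p * q))
     \<le> k * (?E (\<lambda>x. \<bar>f x\<bar> powr 2) - (?E (\<lambda>x. \<bar>f x\<bar>))\<^sup>2)"
    using Beckner_variance_bound[of "\<lambda>x. \<bar>f x\<bar>" "1 / p" q] fm f2 assms(8,9)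
    unfolding pq Lq_norm_def k_def real_norm_def by simp
  also have "\<dots> \<le> k * (C\<^sub>P\<^sup>2 * ?D\<^sup>2)"
    using abs_var k by (rule mult_left_mono)
  also have "\<dots> = beckner_const C\<^sub>P p q * ?D\<^sup>2"
    by (simp add: k_def beckner_const_def mult_ac)
  finally show ?thesis .
qed

end
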